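(* Let $\lambda_0\ge\lambda_1\ge\dots\ge\lambda_{2m}$ be real numbers and let $a_0,a_1,\dots,a_m$ be nonnegative real numbers satisfying all of the following conditions: (1) for each $k=1,2,\dots,m$ there is $j_k\in\{2k-1,2k\}$ such that $a_k\ge\lambda_{j_k}$ and $$\sum_{i=0}^{2(k-1)}\lambda_i+\lambda_{j_k}\ge 2\sum_{i=1}^{k}a_i;$$ (2) $2a_k\ge\lambda_{2k-1}+\lambda_{2k}$ for each $k=1,2,\dots,m$; (3) $\displaystyle\sum_{i=0}^{2m}\lambda_i=a_0+2\sum_{i=1}^{m}a_i$. Then there is a $(2m+1)\times(2m+1)$ nonnegative bisymmetric matrix with eigenvalues (counted with multiplicity) $\lambda_0,\lambda_1,\dots,\lambda_{2m}$ and with diagonal entries, in order, $a_m,a_{m-1},\dots,a_1,a_0,a_1,\dots,a_{m-1},a_m$.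
   Context: All matrices are real. A square matrix $Q$ is bisymmetric if $Q^T=Q$ and $JQJ=Q$, where $J$ is the reverse identity matrix (ones on the anti-diagonal, zeros elsewhere). A matrix is nonnegative if all its entries are $\ge 0$. *)

theory Defs
  imports "Jordan_Normal_Form.Char_Poly"
begin

definition rev_id_mat :: "nat \<Rightarrow> real mat" where
  "rev_id_mat n = mat n n (\<lambda>(i, j). if i + j + 1 = n then 1 else 0)"

definition bisymmetric :: "real mat \<Rightarrow> bool" where
  "bisymmetric Q \<longleftrightarrow> square_mat Q \<and> transpose_mat Q = Q \<and>
     rev_id_mat (dim_row Q) * Q * rev_id_mat (dim_row Q) = Q"

definition nonneg_mat :: "real mat \<Rightarrow> bool" where
  "nonneg_mat A \<longleftrightarrow> (\<forall>i < dim_row A. \<forall>j < dim_col A. A $$ (i, j) \<ge> 0)"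

end

theory Submission
  imports Defs
begin

text \<open>Index the rows by the integers \<open>-k..k\<close>, so that \<open>J\<close> becomes negation, and grow the
matrix from its centre by induction on \<open>k\<close>. After step \<open>k\<close> it has eigenvalues
\<open>l 0, \<dots>, l (2 * k)\<close>, diagonal entries \<open>a \<bar>i\<bar>\<close> for \<open>i \<noteq> 0\<close>, and central entry
\<open>c = l 0 + \<dots> + l (2 * k) - 2 * (a 1 + \<dots> + a k)\<close>. As in Fiedler's gluing construction, the
central entry is then replaced by a 3 x 3 bisymmetric block on the indices \<open>-(k+1), 0, k+1\<close> with
eigenvalue \<open>c\<close> for a nonnegative unit eigenvector \<open>(u, v, u)\<close>, and with the next two
eigenvalues \<open>l j1\<close> (antisymmetric eigenvector) and \<open>l j2\<close>. The rest of the central row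
and column is spread out by the factors \<open>u, v, u\<close>. The hypotheses say precisely that the new
central entry lies between \<open>l j2\<close> and \<open>c\<close>, so that the block exists, and that its corner
entry \<open>a (k+1) - l j1\<close> is nonnegative.\<close>

section \<open>Matrix entries as sums over eigenpairs\<close>

text \<open>For orthonormal \<open>p n\<close> this is an entry of the matrix with eigenpairs
  \<open>l n\<close>, \<open>p n\<close>. With \<open>l\<close> constantly 1 it is the inner product
  of rows \<open>i\<close> and \<open>j\<close> of the eigenvector matrix.\<close>

definition spectral_sum :: "(nat \<Rightarrow> real) \<Rightarrow> (nat \<Rightarrow> 'a \<Rightarrow> real) \<Rightarrow> nat \<Rightarrow> 'a \<Rightarrow> 'a \<Rightarrow> real" where
  "spectral_sum l p N i j = (\<Sum>n\<le>N. l n * p n i * p n j)"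

lemma spectral_sum_commute: "spectral_sum l p N i j = spectral_sum l p N j i"
  unfolding spectral_sum_def by (intro sum.cong) auto

text \<open>Old vectors, pulled back along \<open>f\<close> and rescaled by \<open>w\<close>,
  contribute a multiple of an old entry. The order of \<open>j1\<close> and \<open>j2\<close> is
  left open because condition (1) may select either index.\<close>

lemma spectral_sum_extend:
  assumes "{j1, j2} = {Suc N, Suc (Suc N)}"
    and "\<And>n i. n \<le> N \<Longrightarrow> q n i = w i * p n (f i)"
  shows "spectral_sum l q (Suc (Suc N)) i j =
    w i * w j * spectral_sum l p N (f i) (f j) + l j1 * q j1 i * q j1 j + l j2 * q j2 i * q j2 j"
proof -
  have "(\<Sum>n\<le>N. l n * q n i * q n j) = w i * w j * (\<Sum>n\<le>N. l n * p n (f i) * p n (f j))"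
    unfolding sum_distrib_left by (intro sum.cong) (auto simp: assms(2))
  moreover have "j1 = Suc N \<and> j2 = Suc (Suc N) \<or> j2 = Suc N \<and> j1 = Suc (Suc N)"
    using assms(1) by (auto simp: doubleton_eq_iff)
  ultimately show ?thesis
    by (auto simp: spectral_sum_def)
qed

text \<open>\<open>d\<close> is a convex combination of \<open>c\<close> and \<open>e\<close>; the
  weights are the square roots of its coefficients.\<close>

lemma exists_unit_weights:
  fixes c d e :: real
  assumes "e \<le> d" "d \<le> c"
  obtains v w where "0 \<le> v" "0 \<le> w" "v\<^sup>2 + w\<^sup>2 = 1" "c * v\<^sup>2 + e * w\<^sup>2 = d"
proof -
  \<comment> \<open>If \<open>c = e\<close>, then \<open>d\<close> equals both and any coefficient
    would do.\<close>
  define t where "t = (if c = e then 1 else (d - e) / (c - e))"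
  have t: "0 \<le> t" "t \<le> 1" "(1 - t) * e + t * c = d"
    using assms by (auto simp: t_def divide_simps) (auto simp: algebra_simps)
  show ?thesis
    by (rule that[of "sqrt t" "sqrt (1 - t)"]) (use t in \<open>auto simp: algebra_simps\<close>)
qed

section \<open>Growing the matrix from its centre\<close>

text \<open>Orthonormality is stated for the rows of the eigenvector matrix. The centre has its own
  value \<open>c\<close>, since every step replaces it. Signs are imposed off the diagonal only; on
  the final diagonal they come from \<open>a\<close>.\<close>

definition symmetric_realization ::
  "(nat \<Rightarrow> real) \<Rightarrow> (nat \<Rightarrow> real) \<Rightarrow> nat \<Rightarrow> real \<Rightarrow> (nat \<Rightarrow> int \<Rightarrow> real) \<Rightarrow> bool" where
  "symmetric_realization l a k c p \<longleftrightarrow>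
    (\<forall>i\<in>{- int k..int k}. \<forall>j\<in>{- int k..int k}.
      spectral_sum (\<lambda>_. 1) p (2 * k) i j = of_bool (i = j) \<and>
      spectral_sum l p (2 * k) (- i) (- j) = spectral_sum l p (2 * k) i j \<and>
      (i \<noteq> j \<longrightarrow> 0 \<le> spectral_sum l p (2 * k) i j) \<and>
      (i \<noteq> 0 \<longrightarrow> spectral_sum l p (2 * k) i i = a (nat \<bar>i\<bar>))) \<and>
    spectral_sum l p (2 * k) 0 0 = c"

lemma symmetric_realizationD:
  assumes "symmetric_realization l a k c p" "\<bar>i\<bar> \<le> int k" "\<bar>j\<bar> \<le> int k"
  shows "spectral_sum (\<lambda>_. 1) p (2 * k) i j = of_bool (i = j)"
    and "spectral_sum l p (2 * k) (- i) (- j) = spectral_sum l p (2 * k) i j"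
    and "i \<noteq> j \<Longrightarrow> 0 \<le> spectral_sum l p (2 * k) i j"
    and "i \<noteq> 0 \<Longrightarrow> spectral_sum l p (2 * k) i i = a (nat \<bar>i\<bar>)"
    and "spectral_sum l p (2 * k) 0 0 = c"
proof -
  have "i \<in> {- int k..int k}" "j \<in> {- int k..int k}"
    using assms(2,3) by auto
  then show "spectral_sum (\<lambda>_. 1) p (2 * k) i j = of_bool (i = j)"
    and "spectral_sum l p (2 * k) (- i) (- j) = spectral_sum l p (2 * k) i j"
    and "i \<noteq> j \<Longrightarrow> 0 \<le> spectral_sum l p (2 * k) i j"
    and "i \<noteq> 0 \<Longrightarrow> spectral_sum l p (2 * k) i i = a (nat \<bar>i\<bar>)"
    and "spectral_sum l p (2 * k) 0 0 = c"
    using assms(1) unfolding symmetric_realization_def by blast+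
qed

text \<open>The equation for the new central entry \<open>d\<close> is the trace of the 3 x 3
  block.\<close>

lemma symmetric_realization_Suc:
  assumes p: "symmetric_realization l a k c p"
    and j: "{j1, j2} = {Suc (2 * k), Suc (Suc (2 * k))}"
    and a: "l j1 \<le> a (Suc k)"
    and d: "l j2 \<le> d" "d \<le> c" "d + 2 * a (Suc k) = c + l j1 + l j2"
  shows "\<exists>q. symmetric_realization l a (Suc k) d q"
proof -
  obtain v w where vw: "0 \<le> v" "0 \<le> w" "v\<^sup>2 + w\<^sup>2 = 1" "c * v\<^sup>2 + l j2 * w\<^sup>2 = d"
    using exists_unit_weights[OF d(1,2)] .
  \<comment> \<open>On \<open>(-s, 0, s)\<close> the new orthonormal eigenvectors are \<open>(hw, v, hw)\<close>, \<open>(-h, 0, h)\<close> and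
    \<open>(hv, -w, hv)\<close>; the first one glues the old vectors, the others are \<open>x\<close> and \<open>y\<close>.\<close>
  define h :: real where "h = sqrt (1 / 2)"
  have h: "0 \<le> h" "h * h = 1 / 2"
    by (auto simp: h_def)
  define s where "s = int (Suc k)"
  \<comment> \<open>\<open>f\<close> sends the new indices \<open>s\<close> and \<open>- s\<close>
    to the old centre, so that they and 0 all carry copies of the old central row, scaled by
    \<open>b\<close>.\<close>
  define f where "f i = (if \<bar>i\<bar> \<le> int k then i else 0)" for i
  define b where "b i = (if i = 0 then v else if \<bar>i\<bar> \<le> int k then 1 else h * w)" for i
  define x where "x i = (if i = s then h else if i = - s then - h else 0)" for i
  define y where "y i = (if i = 0 then - w else if \<bar>i\<bar> \<le> int k then 0 else h * v)" for i
  define q where "q n i = (if n = j1 then x i else if n = j2 then y i else b i * p n (f i))" for n i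
  have jne: "j1 \<noteq> j2" "j1 > 2 * k" "j2 > 2 * k"
    using j by (auto simp: doubleton_eq_iff)
  define S where "S r = spectral_sum r q (2 * Suc k)" for r
  have q: "S r i i' =
      b i * b i' * spectral_sum r p (2 * k) (f i) (f i') + r j1 * x i * x i' + r j2 * y i * y i'"
    for r i i'
    using spectral_sum_extend[OF j, of q b p f r i i'] jne by (auto simp: q_def S_def)
  note pD = symmetric_realizationD[OF p]
  have p5: "spectral_sum l p (2 * k) 0 0 = c"
    using pD(5)[of 0 0] by simp
  have old: "f i = i" "b i = 1" "x i = 0" "y i = 0" if "i \<noteq> 0" "\<bar>i\<bar> \<le> int k" for i
    using that by (auto simp: f_def b_def x_def y_def s_def)
  have zero: "f 0 = 0" "b 0 = v" "x 0 = 0" "y 0 = - w"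
    by (auto simp: f_def b_def x_def y_def s_def)
  have new: "f s = 0" "b s = h * w" "x s = h" "y s = h * v"
      "f (- s) = 0" "b (- s) = h * w" "x (- s) = - h" "y (- s) = h * v" "s \<noteq> 0"
    by (auto simp: f_def b_def x_def y_def s_def)
  have hh: "h * (h * z) = z / 2" for z
    using h(2) by (simp flip: mult.assoc)
  have w2: "w * w = 1 - v * v" and cv: "c * (v * v) + l j2 * (w * w) = d"
    using vw by (auto simp: power2_eq_square)
  \<comment> \<open>The rotation by \<open>v\<close>, \<open>w\<close> preserves the trace
    \<open>c + l j2\<close>, of which \<open>d\<close> stays at the centre. The rest yields the
    entries \<open>a (Suc k)\<close> at \<open>(s, s)\<close> and \<open>a (Suc k) - l j1\<close> at
    \<open>(s, - s)\<close>.\<close>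
  have "w * w * c + v * v * l j2 = c + l j2 - (c * (v * v) + l j2 * (w * w))"
    by (simp add: w2 algebra_simps)
  then have corner: "w * w * c + l j1 + v * v * l j2 = 2 * a (Suc k)"
    "w * w * c - l j1 + v * v * l j2 = 2 * (a (Suc k) - l j1)"
    using cv d(3) by (simp_all add: algebra_simps)
  let ?T = "\<lambda>r. spectral_sum r p (2 * k)"
  \<comment> \<open>Letters in the fact names: \<open>o\<close> for an old nonzero index,
    \<open>z\<close> for 0, \<open>n\<close> for \<open>s\<close> or \<open>- s\<close>.
    \<open>r\<close> stays general to cover both orthonormality (\<open>r\<close> constantly 1) and
    the matrix itself (\<open>r = l\<close>).\<close>
  have oo: "S r i i' = ?T r i i'"
    and oz: "S r i 0 = v * ?T r i 0" "S r 0 i = v * ?T r i 0"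
    and on: "S r i s = h * w * ?T r i 0" "S r i (- s) = h * w * ?T r i 0"
      "S r s i = h * w * ?T r i 0" "S r (- s) i = h * w * ?T r i 0"
    if "i \<noteq> 0" "\<bar>i\<bar> \<le> int k" "i' \<noteq> 0" "\<bar>i'\<bar> \<le> int k" for i i' r
    using that by (simp_all add: q old zero new spectral_sum_commute[of r p "2 * k" 0])
  have zz: "S r 0 0 = v * v * ?T r 0 0 + w * w * r j2"
    and zn: "S r 0 s = h * v * w * (?T r 0 0 - r j2)" "S r 0 (- s) = h * v * w * (?T r 0 0 - r j2)"
      "S r s 0 = h * v * w * (?T r 0 0 - r j2)" "S r (- s) 0 = h * v * w * (?T r 0 0 - r j2)"
    and nn: "S r s s = (w * w * ?T r 0 0 + r j1 + v * v * r j2) / 2"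
      "S r (- s) (- s) = (w * w * ?T r 0 0 + r j1 + v * v * r j2) / 2"
      "S r s (- s) = (w * w * ?T r 0 0 + (- r j1) + v * v * r j2) / 2"
      "S r (- s) s = (w * w * ?T r 0 0 + (- r j1) + v * v * r j2) / 2" for r
    by (simp_all add: q zero new algebra_simps hh)
  have cases: "i = 0 \<or> i = s \<or> i = - s \<or> i \<noteq> 0 \<and> \<bar>i\<bar> \<le> int k"
    if "i \<in> {- int (Suc k)..int (Suc k)}" for i
    using that by (auto simp: s_def)
  have s: "s \<noteq> 0" "\<not> \<bar>s\<bar> \<le> int k" "nat \<bar>s\<bar> = Suc k" "s \<noteq> - s"
    by (auto simp: s_def)
  have T1: "?T (\<lambda>_. 1) 0 0 = 1"
    using pD(1)[of 0 0] by simp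
  have p0: "?T l (- i) 0 = ?T l i 0" if "\<bar>i\<bar> \<le> int k" for i
    using pD(2)[of i 0] that by simp
  \<comment> \<open>This gives the sign of the entries \<open>h * v * w * (c - l j2)\<close> joining
    0 to \<open>s\<close> and \<open>- s\<close>.\<close>
  have "l j2 \<le> c" using d by simp
  have orth: "S (\<lambda>_. 1) i i' = of_bool (i = i')"
    and centro: "S l (- i) (- i') = S l i i'"
    and nonneg: "i \<noteq> i' \<Longrightarrow> 0 \<le> S l i i'"
    and diag: "i \<noteq> 0 \<Longrightarrow> S l i i = a (nat \<bar>i\<bar>)"
    if "i \<in> {- int (Suc k)..int (Suc k)}" "i' \<in> {- int (Suc k)..int (Suc k)}" for i i'
    subgoal using cases[OF that(1)] cases[OF that(2)] s
      by (elim disjE) (auto simp: oo oz on zz zn nn pD(1) T1 w2)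
    subgoal using cases[OF that(1)] cases[OF that(2)] s
      by (elim disjE) (auto simp: oo oz on zz zn nn pD(2) p0)
    subgoal using cases[OF that(1)] cases[OF that(2)] s
      using h vw a \<open>l j2 \<le> c\<close> by (elim disjE) (auto simp: oo oz on zz zn nn pD(3) p5 corner)
    subgoal using cases[OF that(1)] s
      by (elim disjE) (auto simp: oo nn pD(4) p5 corner)
    done
  moreover have "S l 0 0 = d"
    using cv by (simp add: zz p5 mult.commute[of _ c] mult.commute[of _ "l j2"])
  ultimately show ?thesis
    unfolding symmetric_realization_def S_def by blast
qed

text \<open>The central entry is forced by the trace; for \<open>k = m\<close> condition (3) makes
  it \<open>a 0\<close>.\<close>

lemma exists_symmetric_realization:
  assumes cond1: "\<And>k. k \<in> {1..m} \<Longrightarrow>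
      \<exists>j \<in> {2 * k - 1, 2 * k}. a k \<ge> l j \<and>
        (\<Sum>i = 0..2 * (k - 1). l i) + l j \<ge> 2 * (\<Sum>i = 1..k. a i)"
    and cond2: "\<And>k. k \<in> {1..m} \<Longrightarrow> 2 * a k \<ge> l (2 * k - 1) + l (2 * k)"
    and "k \<le> m"
  shows "\<exists>p. symmetric_realization l a k ((\<Sum>i = 0..2 * k. l i) - 2 * (\<Sum>i = 1..k. a i)) p"
  using \<open>k \<le> m\<close>
proof (induction k)
  case 0
  have "symmetric_realization l a 0 (l 0) (\<lambda>_ _. 1)"
    by (auto simp: symmetric_realization_def spectral_sum_def)
  then show ?case by auto
next
  case (Suc k)
  define c where "c = (\<Sum>i = 0..2 * k. l i) - 2 * (\<Sum>i = 1..k. a i)"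
  define d where "d = (\<Sum>i = 0..2 * Suc k. l i) - 2 * (\<Sum>i = 1..Suc k. a i)"
  obtain p where p: "symmetric_realization l a k c p"
    using Suc by (auto simp: c_def)
  have k: "Suc k \<in> {1..m}"
    using Suc.prems by auto
  obtain j1 where j1: "j1 \<in> {Suc (2 * k), Suc (Suc (2 * k))}" "l j1 \<le> a (Suc k)"
      "(\<Sum>i = 0..2 * k. l i) + l j1 \<ge> 2 * (\<Sum>i = 1..Suc k. a i)"
    using cond1[OF k] by auto
  \<comment> \<open>The two candidate indices add up to \<open>4 * k + 3\<close>, so
    \<open>j2\<close> is the other one.\<close>
  define j2 where "j2 = 4 * k + 3 - j1"
  have j: "{j1, j2} = {Suc (2 * k), Suc (Suc (2 * k))}"
    using j1(1) by (auto simp: j2_def)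
  have l: "l (Suc (2 * k)) + l (Suc (Suc (2 * k))) = l j1 + l j2"
    using j by (auto simp: doubleton_eq_iff)
  have d_eq: "d = (\<Sum>i = 0..2 * k. l i) + l j1 + l j2 - 2 * (\<Sum>i = 1..Suc k. a i)"
    using l by (simp add: d_def)
  have "\<exists>q. symmetric_realization l a (Suc k) d q"
  proof (rule symmetric_realization_Suc[OF p j])
    show "l j1 \<le> a (Suc k)" by fact
    \<comment> \<open>The sum inequality of condition (1) gives this lower bound, condition (2) the
      upper bound \<open>c\<close>.\<close>
    show "l j2 \<le> d" using j1(3) d_eq by simp
    show "d \<le> c" using cond2[OF k] l d_eq by (simp add: c_def)
    show "d + 2 * a (Suc k) = c + l j1 + l j2" using d_eq by (simp add: c_def)
  qed
  then show ?case by (simp only: d_def)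
qed

section \<open>Characteristic polynomial and conjugation by J\<close>

lemma char_poly_orthogonal_diagonalization:
  fixes P :: "real mat"
  assumes P: "P \<in> carrier_mat n n" and PP: "P * transpose_mat P = 1\<^sub>m n"
  shows "char_poly (P * mat_diag n l * transpose_mat P) = (\<Prod>i<n. [:- l i, 1:])"
proof -
  have D: "mat_diag n l \<in> carrier_mat n n"
    by (simp add: mat_diag_def)
  have "transpose_mat P * P = 1\<^sub>m n"
    using mat_mult_left_right_inverse[OF P _ PP] P by simp
  then have "similar_mat (P * mat_diag n l * transpose_mat P) (mat_diag n l)"
    unfolding similar_mat_def
    by (intro exI[of _ P] exI[of _ "transpose_mat P"] similar_mat_witI[OF PP _ refl])
      (use P D in auto)
  then have "char_poly (P * mat_diag n l * transpose_mat P) = char_poly (mat_diag n l)"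
    by (rule char_poly_similar)
  also have "\<dots> = (\<Prod>x\<leftarrow>diag_mat (mat_diag n l). [:- x, 1:])"
    by (rule char_poly_upper_triangular[OF D]) (auto simp: mat_diag_def)
  also have "diag_mat (mat_diag n l) = map l [0..<n]"
    by (auto simp: diag_mat_def mat_diag_def)
  also have "(\<Prod>x\<leftarrow>map l [0..<n]. [:- x, 1:]) = (\<Prod>i<n. [:- l i, 1:])"
    by (simp add: prod.distinct_set_conv_list[symmetric] o_def atLeast0LessThan)
  finally show ?thesis .
qed

lemma rev_id_mat_conjugate:
  assumes A: "A \<in> carrier_mat n n"
  shows "rev_id_mat n * A * rev_id_mat n = mat n n (\<lambda>(i, j). A $$ (n - 1 - i, n - 1 - j))"
proof -
  \<comment> \<open>Two forms of the same entry: each isolates the index that is summed over when J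
    stands on the left or on the right.\<close>
  have J: "rev_id_mat n $$ (i, j) = of_bool (j = n - 1 - i)"
    "rev_id_mat n $$ (i, j) = of_bool (i = n - 1 - j)" if "i < n" "j < n" for i j
    using that by (auto simp: rev_id_mat_def)
  have delta: "(\<Sum>k = 0..<n. of_bool (k = c) * f k) = f c" if "c < n"
    for c and f :: "nat \<Rightarrow> real"
    using that by (subst sum.remove[of _ c]) auto
  have L: "(rev_id_mat n * A) $$ (i, j) = A $$ (n - 1 - i, j)" if "i < n" "j < n" for i j
  proof -
    have "(rev_id_mat n * A) $$ (i, j) = (\<Sum>k = 0..<n. rev_id_mat n $$ (i, k) * A $$ (k, j))"
      using A that by (auto simp: scalar_prod_def rev_id_mat_def)
    also have "\<dots> = (\<Sum>k = 0..<n. of_bool (k = n - 1 - i) * A $$ (k, j))"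
      using that by (intro sum.cong) (auto simp only: J atLeastLessThan_iff)
    finally show ?thesis using that by (simp only: delta)
  qed
  show ?thesis
  proof (rule eq_matI; clarsimp)
    fix i j assume ij: "i < n" "j < n"
    have "(rev_id_mat n * A * rev_id_mat n) $$ (i, j) =
        (\<Sum>k = 0..<n. (rev_id_mat n * A) $$ (i, k) * rev_id_mat n $$ (k, j))"
      using A ij by (auto simp: scalar_prod_def rev_id_mat_def)
    also have "\<dots> = (\<Sum>k = 0..<n. of_bool (k = n - 1 - j) * A $$ (n - 1 - i, k))"
      using ij by (intro sum.cong) (auto simp only: J(2) L atLeastLessThan_iff mult.commute)
    finally show "(rev_id_mat n * A * rev_id_mat n) $$ (i, j) = A $$ (n - Suc i, n - Suc j)"
      using ij by (simp add: delta)
  qed (auto simp: rev_id_mat_def)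
qed

section \<open>Assembling the matrix with rows numbered from 0\<close>

theorem theorem5p2:
  fixes m :: nat and l a :: "nat \<Rightarrow> real"
  assumes ordered: "\<And>i j. i \<le> j \<Longrightarrow> j \<le> 2 * m \<Longrightarrow> l i \<ge> l j"
    and nonneg: "\<And>k. k \<le> m \<Longrightarrow> a k \<ge> 0"
    and cond1: "\<And>k. k \<in> {1..m} \<Longrightarrow>
      \<exists>j \<in> {2 * k - 1, 2 * k}. a k \<ge> l j \<and>
        (\<Sum>i = 0..2 * (k - 1). l i) + l j \<ge> 2 * (\<Sum>i = 1..k. a i)"
    and cond2: "\<And>k. k \<in> {1..m} \<Longrightarrow> 2 * a k \<ge> l (2 * k - 1) + l (2 * k)"
    and cond3: "(\<Sum>i = 0..2 * m. l i) = a 0 + 2 * (\<Sum>i = 1..m. a i)"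
  shows "\<exists>Q :: real mat. Q \<in> carrier_mat (2 * m + 1) (2 * m + 1) \<and>
    nonneg_mat Q \<and> bisymmetric Q \<and>
    char_poly Q = (\<Prod>i = 0..2 * m. [:- l i, 1:]) \<and>
    diag_mat Q = map a (rev [1..<Suc m]) @ [a 0] @ map a [1..<Suc m]"
proof -
  define n where "n = 2 * m + 1"
  have "(\<Sum>i = 0..2 * m. l i) - 2 * (\<Sum>i = 1..m. a i) = a 0"
    using cond3 by simp
  then obtain p where p: "symmetric_realization l a m (a 0) p"
    using exists_symmetric_realization[of m l a m, OF cond1 cond2] by auto
  note pD = symmetric_realizationD[OF p]
  have p_diag: "spectral_sum l p (2 * m) i i = a (nat \<bar>i\<bar>)" if "\<bar>i\<bar> \<le> int m" for i
    using pD(4,5)[OF that that] by (cases "i = 0") auto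
  \<comment> \<open>Row \<open>i\<close> stands for the centred index \<open>i - m\<close>; column
    \<open>k\<close> is the eigenvector for \<open>l k\<close>.\<close>
  define P where "P = mat n n (\<lambda>(i, k). p k (int i - int m))"
  define Q where "Q = P * mat_diag n l * transpose_mat P"
  have P: "P \<in> carrier_mat n n"
    by (simp add: P_def)
  have Q: "Q \<in> carrier_mat n n"
    using P by (auto simp: Q_def)
  have range: "{0..<n} = {..2 * m}"
    by (auto simp: n_def)
  have less_n: "i < n" if "i \<le> 2 * m" for i
    using that by (simp add: n_def)
  have idx: "\<bar>int i - int m\<bar> \<le> int m" if "i < n" for i
    using that by (auto simp: n_def)
  have "P * transpose_mat P = 1\<^sub>m n"
  proof (rule eq_matI)
    fix i j assume "i < dim_row (1\<^sub>m n :: real mat)" "j < dim_col (1\<^sub>m n :: real mat)"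
    then have ij: "i < n" "j < n" by auto
    have "(P * transpose_mat P) $$ (i, j) =
        spectral_sum (\<lambda>_. 1) p (2 * m) (int i - int m) (int j - int m)"
      using ij less_n by (auto simp: P_def scalar_prod_def spectral_sum_def range intro!: sum.cong)
    then show "(P * transpose_mat P) $$ (i, j) = 1\<^sub>m n $$ (i, j)"
      using ij idx by (simp add: pD(1))
  qed (auto simp: P_def)
  then have char: "char_poly Q = (\<Prod>i<n. [:- l i, 1:])"
    unfolding Q_def by (rule char_poly_orthogonal_diagonalization[OF P])
  have Qij: "Q $$ (i, j) = spectral_sum l p (2 * m) (int i - int m) (int j - int m)"
    if "i < n" "j < n" for i j
    using that less_n unfolding Q_def mat_diag_mult_right[OF P]
    by (auto simp: P_def scalar_prod_def spectral_sum_def range intro!: sum.cong)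
  have diag: "Q $$ (i, i) = a (nat \<bar>int i - int m\<bar>)" if "i < n" for i
    using that Qij p_diag idx by auto
  have "nonneg_mat Q"
    unfolding nonneg_mat_def
  proof (intro allI impI)
    fix i j assume "i < dim_row Q" "j < dim_col Q"
    then have ij: "i < n" "j < n" using Q by auto
    show "0 \<le> Q $$ (i, j)"
    proof (cases "i = j")
      case True
      then show ?thesis using ij idx[of j] by (auto simp: diag nat_le_iff intro!: nonneg)
    next
      case False
      then show ?thesis using ij idx by (auto simp: Qij intro!: pD(3))
    qed
  qed
  moreover have "bisymmetric Q"
  proof -
    have "transpose_mat Q = Q"
      using Q by (intro eq_matI) (auto simp: Qij spectral_sum_commute)
    moreover have "rev_id_mat n * Q * rev_id_mat n = Q"
      unfolding rev_id_mat_conjugate[OF Q]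
    proof (rule eq_matI)
      fix i j assume "i < dim_row Q" "j < dim_col Q"
      then have ij: "i < n" "j < n" using Q by auto
      \<comment> \<open>Since \<open>n - 1 = 2 * m\<close>, reversing the rows is negation of the
        centred index.\<close>
      have neg: "int (n - 1 - i) - int m = - (int i - int m)" if "i < n" for i
        using that by (auto simp: n_def)
      have "Q $$ (n - 1 - i, n - 1 - j) = Q $$ (i, j)"
        using ij Qij[OF ij] Qij[of "n - 1 - i" "n - 1 - j"]
        by (simp only: neg pD(2) idx)
      then show "mat n n (\<lambda>(i, j). Q $$ (n - 1 - i, n - 1 - j)) $$ (i, j) = Q $$ (i, j)"
        using ij by simp
    qed (use Q in auto)
    ultimately show ?thesis
      using Q by (auto simp: bisymmetric_def)
  qed
  moreover have "diag_mat Q = map a (rev [1..<Suc m]) @ [a 0] @ map a [1..<Suc m]"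
  proof (rule nth_equalityI)
    show "length (diag_mat Q) = length (map a (rev [1..<Suc m]) @ [a 0] @ map a [1..<Suc m])"
      using Q by (simp add: diag_mat_def n_def)
    fix i assume "i < length (diag_mat Q)"
    then have i: "i < n" using Q by (simp add: diag_mat_def)
    then have "diag_mat Q ! i = a (nat \<bar>int i - int m\<bar>)"
      using Q diag by (simp add: diag_mat_def)
    also have "\<dots> = (map a (rev [1..<Suc m]) @ [a 0] @ map a [1..<Suc m]) ! i"
    proof -
      \<comment> \<open>The \<open>Suc\<close> skips the middle entry \<open>a 0\<close>, so
        \<open>r\<close> is the position in the last list.\<close>
      consider "i < m" | "i = m" | r where "i = Suc (m + r)" "r < m"
        using i less_imp_Suc_add[of m i] by (cases i m rule: linorder_cases) (auto simp: n_def)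
      then show ?thesis
      proof cases
        case 1
        then have "nat \<bar>int i - int m\<bar> = m - i" by simp
        then show ?thesis using 1 by (simp add: nth_append rev_nth Suc_diff_Suc del: upt_Suc)
      next
        case 2
        then show ?thesis by (simp add: nth_append del: upt_Suc)
      next
        case 3
        then have "nat \<bar>int i - int m\<bar> = Suc r" by simp
        then show ?thesis using 3 by (simp add: nth_append del: upt_Suc)
      qed
    qed
    finally show "diag_mat Q ! i = (map a (rev [1..<Suc m]) @ [a 0] @ map a [1..<Suc m]) ! i" .
  qed
  moreover have "{..<n} = {0..2 * m}"
    by (auto simp: n_def)
  then have "char_poly Q = (\<Prod>i = 0..2 * m. [:- l i, 1:])"
    using char by (simp only:)
  moreover have "Q \<in> carrier_mat (2 * m + 1) (2 * m + 1)"
    using Q by (simp only: n_def)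
  ultimately show ?thesis
    by blast
qed

end
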